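(* There is a $2,2$-perfect graph $G$ such that $G^2$ is not perfect.
   Context: All graphs are simple and undirected with nonempty vertex set. $G^2$ is the square of $G$: the graph on $V(G)$ in which two distinct vertices are adjacent if and only if their distance in $G$ is at most $2$. A graph is perfect if $\chi(H)=\omega(H)$ (usual chromatic and clique numbers) for every induced subgraph $H$. A shortest path in a graph $G$ is a path between some vertices $u,v$ whose length (number of edges) equals the graph distance between $u$ and $v$. A set $S\subseteq V(G)$ is $k,d$-independent in $G$ if every shortest path in $G$ of length at most $d$ contains fewer than $k$ vertices of $S$. The $k,d$-chromatic number $\chi^k_d(G)$ is the least positive integer $c$ such that some coloring $V(G)\to\{1,\dots,c\}$ has all color classes $k,d$-independent. A set $S\subseteq V(G)$ is a $k,d$-clique in $G$ if every $k$-element subset of $S$ is contained in some shortest path of $G$ of length at most $d$; $\omega^k_d(G)$ is the supremum of the sizes of $k,d$-cliques in $G$. For $2\le k\le d+1$, $G$ is $k,d$-perfect if $\chi^k_d(H)=\left\lceil\frac{\omega^k_d(H)}{k-1}\right\rceil$ for every induced subgraph $H$ of $G$ (shortest paths being computed in $H$). *)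

theory Defs
  imports "Graph_Theory.Graph_Theory" "HOL-Library.Extended_Nat"
begin

text \<open>
  As in the library, an undirected graph is a symmetric digraph: an edge is a pair of opposite
  arcs. Finiteness is not required, which is why the library locale \<open>graph\<close> is not used.
\<close>

definition simple_graph :: "('a, 'b) pre_digraph \<Rightarrow> bool" where
  "simple_graph G \<longleftrightarrow>
     loopfree_digraph G \<and> nomulti_digraph G \<and> sym_digraph G \<and> verts G \<noteq> {}"

definition distance :: "('a, 'b) pre_digraph \<Rightarrow> 'a \<Rightarrow> 'a \<Rightarrow> ereal" where
  "distance G u v = wf_digraph.\<mu> G (\<lambda>_. 1) u v"

definition graph_square :: "('a, 'b) pre_digraph \<Rightarrow> 'a pair_pre_digraph" where
  "graph_square G =
     \<lparr> pverts = verts G,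
       parcs = {(u, v). u \<in> verts G \<and> v \<in> verts G \<and> u \<noteq> v \<and> distance G u v \<le> 2} \<rparr>"

text \<open>
  Chromatic and clique numbers are extended naturals: a chromatic number is \<open>\<infinity>\<close> if no
  finite number of colours suffices (infimum of the empty set), and a clique number is \<open>\<infinity>\<close>
  if there are arbitrarily large cliques.
\<close>

definition esize :: "'a set \<Rightarrow> enat" where
  "esize S = (if finite S then enat (card S) else \<infinity>)"

definition proper_coloring :: "('a, 'b) pre_digraph \<Rightarrow> nat \<Rightarrow> ('a \<Rightarrow> nat) \<Rightarrow> bool" where
  "proper_coloring G c f \<longleftrightarrow>
     f ` verts G \<subseteq> {1..c} \<and> (\<forall>u v. u \<rightarrow>\<^bsub>G\<^esub> v \<longrightarrow> f u \<noteq> f v)"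

definition chromatic_number :: "('a, 'b) pre_digraph \<Rightarrow> enat" where
  "chromatic_number G = (INF c \<in> {c. 0 < c \<and> (\<exists>f. proper_coloring G c f)}. enat c)"

definition clique :: "('a, 'b) pre_digraph \<Rightarrow> 'a set \<Rightarrow> bool" where
  "clique G S \<longleftrightarrow> S \<subseteq> verts G \<and> (\<forall>u\<in>S. \<forall>v\<in>S. u \<noteq> v \<longrightarrow> u \<rightarrow>\<^bsub>G\<^esub> v)"

definition clique_number :: "('a, 'b) pre_digraph \<Rightarrow> enat" where
  "clique_number G = (SUP S \<in> {S. clique G S}. esize S)"

definition perfect :: "('a, 'b) pre_digraph \<Rightarrow> bool" where
  "perfect G \<longleftrightarrow>
     (\<forall>S. S \<subseteq> verts G \<and> S \<noteq> {} \<longrightarrow> chromatic_number (G \<restriction> S) = clique_number (G \<restriction> S))"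

text \<open>A path is given by its list of arcs, so its number of edges is the length of that list.\<close>

definition shortest_path :: "('a, 'b) pre_digraph \<Rightarrow> 'a \<Rightarrow> 'b awalk \<Rightarrow> 'a \<Rightarrow> bool" where
  "shortest_path G u p v \<longleftrightarrow>
     pre_digraph.apath G u p v \<and> ereal (real (length p)) = distance G u v"

definition kd_independent :: "nat \<Rightarrow> nat \<Rightarrow> ('a, 'b) pre_digraph \<Rightarrow> 'a set \<Rightarrow> bool" where
  "kd_independent k d G S \<longleftrightarrow>
     S \<subseteq> verts G \<and>
     (\<forall>u p v. shortest_path G u p v \<and> length p \<le> d \<longrightarrow>
        card (S \<inter> set (pre_digraph.awalk_verts G u p)) < k)"

definition kd_coloring ::
  "nat \<Rightarrow> nat \<Rightarrow> ('a, 'b) pre_digraph \<Rightarrow> nat \<Rightarrow> ('a \<Rightarrow> nat) \<Rightarrow> bool" where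
  "kd_coloring k d G c f \<longleftrightarrow>
     f ` verts G \<subseteq> {1..c} \<and> (\<forall>i\<in>{1..c}. kd_independent k d G {v \<in> verts G. f v = i})"

definition kd_chromatic_number :: "nat \<Rightarrow> nat \<Rightarrow> ('a, 'b) pre_digraph \<Rightarrow> enat" where
  "kd_chromatic_number k d G = (INF c \<in> {c. 0 < c \<and> (\<exists>f. kd_coloring k d G c f)}. enat c)"

definition kd_clique :: "nat \<Rightarrow> nat \<Rightarrow> ('a, 'b) pre_digraph \<Rightarrow> 'a set \<Rightarrow> bool" where
  "kd_clique k d G S \<longleftrightarrow>
     S \<subseteq> verts G \<and>
     (\<forall>T. T \<subseteq> S \<and> finite T \<and> card T = k \<longrightarrow>
        (\<exists>u p v. shortest_path G u p v \<and> length p \<le> d \<and>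
           T \<subseteq> set (pre_digraph.awalk_verts G u p)))"

definition kd_clique_number :: "nat \<Rightarrow> nat \<Rightarrow> ('a, 'b) pre_digraph \<Rightarrow> enat" where
  "kd_clique_number k d G = (SUP S \<in> {S. kd_clique k d G S}. esize S)"

definition ceil_quotient :: "enat \<Rightarrow> nat \<Rightarrow> enat" where
  "ceil_quotient x m = (case x of enat n \<Rightarrow> enat (nat \<lceil>real n / real m\<rceil>) | \<infinity> \<Rightarrow> \<infinity>)"

definition kd_perfect :: "nat \<Rightarrow> nat \<Rightarrow> ('a, 'b) pre_digraph \<Rightarrow> bool" where
  "kd_perfect k d G \<longleftrightarrow>
     2 \<le> k \<and> k \<le> d + 1 \<and>
     (\<forall>S. S \<subseteq> verts G \<and> S \<noteq> {} \<longrightarrow>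
        kd_chromatic_number k d (G \<restriction> S) =
          ceil_quotient (kd_clique_number k d (G \<restriction> S)) (k - 1))"

end

theory Submission
  imports Defs
begin

text \<open>
  \<open>2,2\<close>-independent sets and \<open>2,2\<close>-cliques of a graph are the independent sets and cliques of its
  square, so \<open>2,2\<close>-perfection asks for equal chromatic and clique numbers of \<open>H\<^sup>2\<close> for every induced
  subgraph \<open>H\<close> of \<open>G\<close>, whereas perfection of \<open>G\<^sup>2\<close> concerns the induced subgraphs of \<open>G\<^sup>2\<close>.
  The 9-cycle separates the two. If \<open>H\<close> contains three consecutive vertices, they form a clique of
  \<open>H\<^sup>2\<close>, and colouring modulo 3 is proper because 3 divides 9. Otherwise \<open>H\<^sup>2 = H\<close> is a matching.
  On the other hand, the vertices 0, 2, 4, 6, 8 induce a 5-cycle in the square of the 9-cycle.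
\<close>

section \<open>Walks, distances and adjacency in the square\<close>

lemma dominates_induce_subgraph_iff:
  "u \<rightarrow>\<^bsub>G \<restriction> S\<^esub> v \<longleftrightarrow> u \<in> S \<and> v \<in> S \<and> u \<rightarrow>\<^bsub>G\<^esub> v"
  by (auto simp: arcs_ends_conv)

context wf_digraph
begin

lemma awalk_cost_1: "awalk_cost (\<lambda>_. 1) p = real (length p)"
  by (induction p) auto

text \<open>The distance is an infimum of walk lengths, so a bound on it does not at once name a
  walk. The strict bound \<open>Suc n\<close> does: an infimum below it has a walk below it, and
  lengths are integers.\<close>

lemma distance_le_iff: "distance G u v \<le> ereal (real n) \<longleftrightarrow> (\<exists>p. awalk u p v \<and> length p \<le> n)"
proof
  assume "distance G u v \<le> ereal (real n)"
  then have "distance G u v < ereal (real (Suc n))"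
    by (rule le_less_trans) simp
  then show "\<exists>p. awalk u p v \<and> length p \<le> n"
    by (auto simp: distance_def \<mu>_def INF_less_iff awalk_cost_1 less_Suc_eq_le
        simp del: of_nat_Suc)
next
  assume "\<exists>p. awalk u p v \<and> length p \<le> n"
  then show "distance G u v \<le> ereal (real n)"
    using min_cost_le_walk_cost[of u _ v "\<lambda>_. 1"]
    by (force simp: distance_def awalk_cost_1 intro: order_trans)
qed

text \<open>A walk of least length between the given ends attains the infimum, and it is a path, for
  a repeated vertex would leave a closed piece to cut out.\<close>

lemma ex_shortest_path:
  assumes "awalk u p v"
  obtains q where "shortest_path G u q v" "length q \<le> length p"
proof -
  obtain q where q: "awalk u q v" and min: "\<And>r. awalk u r v \<Longrightarrow> length q \<le> length r"
    using assms ex_has_least_nat[of "\<lambda>q. awalk u q v" p length] by blast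
  have "distinct (awalk_verts u q)"
  proof (rule ccontr)
    assume "\<not> distinct (awalk_verts u q)"
    then obtain q1 c q2 where "q = q1 @ c @ q2" "c \<noteq> []" "awalk u (q1 @ q2) v"
      using awalk_not_distinct_decomp[OF q] awalk_appendI by (metis closed_w_def length_greater_0_conv)
    then show False
      using min[of "q1 @ q2"] by simp
  qed
  moreover have "distance G u v = ereal (real (length q))"
    unfolding distance_def \<mu>_def awalk_cost_1
    using q min by (intro antisym INF_lower2 INF_greatest) auto
  ultimately have "shortest_path G u q v"
    using q by (simp add: shortest_path_def apath_def)
  then show thesis
    using that min[OF assms] by blast
qed

lemma dominates_iff: "u \<rightarrow>\<^bsub>G\<^esub> v \<longleftrightarrow> (\<exists>e\<in>arcs G. tail G e = u \<and> head G e = v)"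
  unfolding arcs_ends_conv by blast

lemma awalk_length_1_iff: "(\<exists>p. awalk u p v \<and> length p = 1) \<longleftrightarrow> u \<rightarrow>\<^bsub>G\<^esub> v"
proof -
  have "(\<exists>p. awalk u p v \<and> length p = 1) \<longleftrightarrow> (\<exists>e. awalk u [e] v)"
    by (auto simp: length_Suc_conv)
  also have "\<dots> \<longleftrightarrow> u \<rightarrow>\<^bsub>G\<^esub> v"
    unfolding dominates_iff awalk_simps by auto
  finally show ?thesis .
qed

lemma awalk_length_2_iff:
  "(\<exists>p. awalk u p v \<and> length p = 2) \<longleftrightarrow> (\<exists>w. u \<rightarrow>\<^bsub>G\<^esub> w \<and> w \<rightarrow>\<^bsub>G\<^esub> v)"
proof -
  have "(\<exists>p. awalk u p v \<and> length p = 2) \<longleftrightarrow> (\<exists>e f. awalk u [e, f] v)"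
    by (auto simp: numeral_2_eq_2 length_Suc_conv)
  also have "\<dots> \<longleftrightarrow> (\<exists>w. u \<rightarrow>\<^bsub>G\<^esub> w \<and> w \<rightarrow>\<^bsub>G\<^esub> v)"
    unfolding dominates_iff awalk_simps by (auto; metis head_in_verts)
  finally show ?thesis .
qed

lemma graph_square_dominates_iff_awalk:
  "u \<rightarrow>\<^bsub>with_proj (graph_square G)\<^esub> v \<longleftrightarrow> u \<noteq> v \<and> (\<exists>p. awalk u p v \<and> length p \<le> 2)"
  using distance_le_iff[of u v 2] by (auto simp: graph_square_def)

text \<open>This walk-free form is what the computations in the 9-cycle use. The empty walk drops
  out because of \<open>u \<noteq> v\<close>.\<close>

lemma graph_square_dominates_iff:
  "u \<rightarrow>\<^bsub>with_proj (graph_square G)\<^esub> v \<longleftrightarrow>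
    u \<noteq> v \<and> (u \<rightarrow>\<^bsub>G\<^esub> v \<or> (\<exists>w. u \<rightarrow>\<^bsub>G\<^esub> w \<and> w \<rightarrow>\<^bsub>G\<^esub> v))"
proof -
  have "length p \<le> 2 \<longleftrightarrow> p = [] \<or> length p = 1 \<or> length p = 2" for p :: "'b awalk"
    unfolding length_0_conv[symmetric] by linarith
  then have "(\<exists>p. awalk u p v \<and> length p \<le> 2) \<longleftrightarrow>
      awalk u [] v \<or> (\<exists>p. awalk u p v \<and> length p = 1) \<or> (\<exists>p. awalk u p v \<and> length p = 2)"
    by auto
  then show ?thesis
    unfolding graph_square_dominates_iff_awalk awalk_length_1_iff awalk_length_2_iff
    by (auto simp: awalk_Nil_iff)
qed

lemma ex_shortest_path_if_graph_square_dominates: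
  assumes "u \<rightarrow>\<^bsub>with_proj (graph_square G)\<^esub> v"
  obtains p where "shortest_path G u p v" "length p \<le> 2" "{u, v} \<subseteq> set (awalk_verts u p)"
proof -
  obtain q where q: "awalk u q v" "length q \<le> 2"
    using assms unfolding graph_square_dominates_iff_awalk by auto
  from q(1) obtain p where p: "shortest_path G u p v" "length p \<le> length q"
    by (rule ex_shortest_path)
  then have "awalk u p v"
    by (simp add: shortest_path_def apath_def)
  then have "{u, v} \<subseteq> set (awalk_verts u p)"
    by (auto intro: hd_in_awalk_verts)
  then show thesis
    using that p q(2) by simp
qed

text \<open>Any two vertices of such a walk are joined by one or two of its arcs. The conclusion is
  a disjunction because the digraph need not be symmetric here and the order of \<open>x\<close> and
  \<open>y\<close> along the walk is not known.\<close>

lemma graph_square_dominates_if_mem_awalk_verts: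
  assumes "awalk u p v" "length p \<le> 2" "x \<in> set (awalk_verts u p)" "y \<in> set (awalk_verts u p)" "x \<noteq> y"
  shows "x \<rightarrow>\<^bsub>with_proj (graph_square G)\<^esub> y \<or> y \<rightarrow>\<^bsub>with_proj (graph_square G)\<^esub> x"
proof -
  consider "p = []" | e where "p = [e]" | e f where "p = [e, f]"
    \<comment> \<open>The rule serves only as a case split of lists: empty, one element, at least
      two.\<close>
    using assms(2) by (cases p rule: remdups_adj.cases) auto
  then show ?thesis
  proof cases
    case 1
    then show ?thesis
      using assms(3-5) by simp
  next
    case 2
    then have "u \<rightarrow>\<^bsub>G\<^esub> v" "{x, y} \<subseteq> {u, v}"
      using assms(1,3,4) by (auto simp: awalk_simps dominates_iff)
    then show ?thesis
      using assms(5) unfolding graph_square_dominates_iff by blast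
  next
    case 3
    then have "u \<rightarrow>\<^bsub>G\<^esub> head G e" "head G e \<rightarrow>\<^bsub>G\<^esub> v" "{x, y} \<subseteq> {u, head G e, v}"
      using assms(1,3,4) by (auto simp: awalk_simps dominates_iff)
    then show ?thesis
      using assms(5) unfolding graph_square_dominates_iff by blast
  qed
qed

end

section \<open>The 2,2-notions of a graph as notions of its square\<close>

context sym_digraph
begin

text \<open>Two vertices of \<open>S\<close> on a shortest path of length at most 2 are the same
  thing as an edge of the square inside \<open>S\<close>: the ends of an edge lie on such a path,
  and two vertices of such a path form an edge.\<close>

lemma kd_independent_2_2_iff:
  "kd_independent 2 2 G S \<longleftrightarrow>
    S \<subseteq> verts G \<and> (\<forall>u\<in>S. \<forall>v\<in>S. \<not> u \<rightarrow>\<^bsub>with_proj (graph_square G)\<^esub> v)"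
  (is "?L \<longleftrightarrow> ?R")
proof
  assume L: ?L
  have False if uv: "u \<in> S" "v \<in> S" "u \<rightarrow>\<^bsub>with_proj (graph_square G)\<^esub> v" for u v
  proof -
    obtain q where q: "shortest_path G u q v" "length q \<le> 2" "{u, v} \<subseteq> set (awalk_verts u q)"
      using uv(3) by (rule ex_shortest_path_if_graph_square_dominates)
    then have "card (S \<inter> set (awalk_verts u q)) < 2"
      using L unfolding kd_independent_def by blast
    moreover have "{u, v} \<subseteq> S \<inter> set (awalk_verts u q)"
      using q(3) uv by simp
    moreover have "u \<noteq> v"
      using uv(3) unfolding graph_square_dominates_iff by blast
    ultimately show False
      using card_mono[of "S \<inter> set (awalk_verts u q)" "{u, v}"] by simp
  qed
  then show ?R
    using L by (auto simp: kd_independent_def)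
next
  assume R: ?R
  have "card (S \<inter> set (awalk_verts u p)) < 2" if "shortest_path G u p v" "length p \<le> 2" for u p v
  proof (rule ccontr)
    assume "\<not> card (S \<inter> set (awalk_verts u p)) < 2"
    then have "\<not> card (S \<inter> set (awalk_verts u p)) \<le> Suc 0"
      by simp
    then obtain x y where "x \<in> S \<inter> set (awalk_verts u p)" "y \<in> S \<inter> set (awalk_verts u p)" "x \<noteq> y"
      by (subst (asm) card_le_Suc0_iff_eq) auto
    then show False
      using R graph_square_dominates_if_mem_awalk_verts[of u p v x y] that
      by (auto simp: shortest_path_def apath_def)
  qed
  then show ?L
    using R by (auto simp: kd_independent_def)
qed

lemma graph_square_dominates_sym:
  "u \<rightarrow>\<^bsub>with_proj (graph_square G)\<^esub> v \<Longrightarrow> v \<rightarrow>\<^bsub>with_proj (graph_square G)\<^esub> u"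
  using arcs_ends_symmetric[OF sym_arcs] unfolding graph_square_dominates_iff by blast

text \<open>An edge of the square with both ends of one colour is exactly what makes a class
  dependent. For an edge at \<open>u\<close> the class to inspect is that of
  \<open>f u\<close>.\<close>

lemma kd_coloring_2_2_iff:
  "kd_coloring 2 2 G c f \<longleftrightarrow> proper_coloring (with_proj (graph_square G)) c f"
proof -
  have in_verts: "u \<in> verts G" "v \<in> verts G" if "u \<rightarrow>\<^bsub>with_proj (graph_square G)\<^esub> v" for u v
    using that by (simp_all add: graph_square_def)
  have verts: "verts (with_proj (graph_square G)) = verts G"
    by (simp add: graph_square_def)
  show ?thesis
  proof
    assume col: "kd_coloring 2 2 G c f"
    have "f u \<noteq> f v" if uv: "u \<rightarrow>\<^bsub>with_proj (graph_square G)\<^esub> v" for u v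
    proof
      assume eq: "f u = f v"
      have "f u \<in> {1..c}"
        using col in_verts(1)[OF uv] unfolding kd_coloring_def by blast
      then have "kd_independent 2 2 G {w \<in> verts G. f w = f u}"
        using col unfolding kd_coloring_def by blast
      then show False
        using uv in_verts[OF uv] eq unfolding kd_independent_2_2_iff by simp
    qed
    then show "proper_coloring (with_proj (graph_square G)) c f"
      using col by (simp add: kd_coloring_def proper_coloring_def verts del: with_proj_simps)
  next
    assume "proper_coloring (with_proj (graph_square G)) c f"
    then have f: "f ` verts G \<subseteq> {1..c}"
      and ne: "\<And>u v. u \<rightarrow>\<^bsub>with_proj (graph_square G)\<^esub> v \<Longrightarrow> f u \<noteq> f v"
      by (simp_all add: proper_coloring_def verts del: with_proj_simps)
    have "kd_independent 2 2 G {v \<in> verts G. f v = i}" for i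
      unfolding kd_independent_2_2_iff by (auto simp del: with_proj_simps dest: ne)
    then show "kd_coloring 2 2 G c f"
      using f by (simp add: kd_coloring_def)
  qed
qed

text \<open>A path through a pair need not have the pair as its ends and yields an edge in an
  unknown direction; symmetry of the square settles the direction.\<close>

lemma kd_clique_2_2_iff: "kd_clique 2 2 G S \<longleftrightarrow> clique (with_proj (graph_square G)) S"
proof
  assume S: "kd_clique 2 2 G S"
  have "u \<rightarrow>\<^bsub>with_proj (graph_square G)\<^esub> v" if uv: "u \<in> S" "v \<in> S" "u \<noteq> v" for u v
  proof -
    have "\<exists>a p b. shortest_path G a p b \<and> length p \<le> 2 \<and> T \<subseteq> set (awalk_verts a p)"
      if "T \<subseteq> S" "finite T" "card T = 2" for T
      using S that by (simp add: kd_clique_def)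
    from this[of "{u, v}"] obtain a p b
      where "shortest_path G a p b" "length p \<le> 2" "{u, v} \<subseteq> set (awalk_verts a p)"
      using uv by auto
    moreover from this have "awalk a p b"
      by (simp add: shortest_path_def apath_def)
    ultimately show ?thesis
      using graph_square_dominates_if_mem_awalk_verts[of a p b u v] graph_square_dominates_sym uv(3)
      by blast
  qed
  moreover have "S \<subseteq> verts (with_proj (graph_square G))"
    using S by (simp add: kd_clique_def graph_square_def)
  ultimately show "clique (with_proj (graph_square G)) S"
    by (simp add: clique_def del: with_proj_simps)
next
  assume S: "clique (with_proj (graph_square G)) S"
  show "kd_clique 2 2 G S"
    unfolding kd_clique_def
  proof (intro conjI allI impI)
    show "S \<subseteq> verts G"
      using S by (simp add: clique_def graph_square_def)
    fix T
    assume T: "T \<subseteq> S \<and> finite T \<and> card T = 2"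
    then obtain u v where uv: "T = {u, v}" "u \<noteq> v"
      by (auto simp: card_2_iff)
    then have "u \<rightarrow>\<^bsub>with_proj (graph_square G)\<^esub> v"
      using S T unfolding clique_def by blast
    then obtain q where "shortest_path G u q v" "length q \<le> 2" "{u, v} \<subseteq> set (awalk_verts u q)"
      by (rule ex_shortest_path_if_graph_square_dominates)
    then show "\<exists>u p v. shortest_path G u p v \<and> length p \<le> 2 \<and> T \<subseteq> set (awalk_verts u p)"
      unfolding uv(1) by blast
  qed
qed

end

section \<open>Equal chromatic and clique numbers from a certificate\<close>

text \<open>A clique with as many vertices as there are colours determines both numbers at once,
  since no clique outgrows a proper colouring.\<close>

lemma chromatic_number_eq_clique_numberI:
  assumes f: "proper_coloring G (card T) f" and T: "clique G T" "finite T" "T \<noteq> {}"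
  shows "chromatic_number G = clique_number G"
proof -
  \<comment> \<open>A colouring is injective on a clique, so even the finiteness of \<open>S\<close>
    follows from that of the palette.\<close>
  have le: "esize S \<le> enat c" if S: "clique G S" and g: "proper_coloring G c g" for S c g
  proof -
    have "inj_on g S"
      using S g unfolding clique_def proper_coloring_def inj_on_def by blast
    moreover have "g ` S \<subseteq> {1..c}"
      using S g unfolding clique_def proper_coloring_def by blast
    ultimately have "finite S" "card S \<le> card {1..c}"
      by (meson inj_on_finite card_inj_on_le finite_atLeastAtMost)+
    then show ?thesis by (simp add: esize_def)
  qed
  have "chromatic_number G = enat (card T)"
    unfolding chromatic_number_def
  proof (rule antisym)
    show "(INF c \<in> {c. 0 < c \<and> (\<exists>f. proper_coloring G c f)}. enat c) \<le> enat (card T)"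
      using f T(2,3) by (intro INF_lower) (auto simp: card_gt_0_iff)
    show "enat (card T) \<le> (INF c \<in> {c. 0 < c \<and> (\<exists>f. proper_coloring G c f)}. enat c)"
      using le[OF T(1)] T(2) by (intro INF_greatest) (auto simp: esize_def)
  qed
  moreover have "clique_number G = enat (card T)"
    unfolding clique_number_def
  proof (rule antisym)
    show "(SUP S \<in> {S. clique G S}. esize S) \<le> enat (card T)"
      using le f by (intro SUP_least) auto
    show "enat (card T) \<le> (SUP S \<in> {S. clique G S}. esize S)"
      using T(1,2) by (intro SUP_upper2[of T]) (simp_all add: esize_def)
  qed
  ultimately show ?thesis by simp
qed

lemma ceil_quotient_Suc_0 [simp]: "ceil_quotient x (Suc 0) = x"
  by (cases x) (simp_all add: ceil_quotient_def)

section \<open>The 9-cycle and its arithmetic modulo 9 and 3\<close>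

definition cycle9_adj :: "nat \<Rightarrow> nat \<Rightarrow> bool" where
  "cycle9_adj u v \<longleftrightarrow> v = Suc u mod 9 \<or> u = Suc v mod 9"

definition cycle9 :: "nat pair_pre_digraph" where
  "cycle9 = \<lparr> pverts = {..<9}, parcs = {(u, v). u < 9 \<and> v < 9 \<and> cycle9_adj u v} \<rparr>"

lemma cycle9_adj_sym: "cycle9_adj u v \<Longrightarrow> cycle9_adj v u"
  by (auto simp: cycle9_adj_def)

text \<open>Two steps between distinct vertices cannot turn back, so both go the same way round. If
  \<open>w\<close> were the successor of both ends, injectivity of the successor on residues would
  identify them; if both were the successor of \<open>w\<close>, they would be equal at
  once.\<close>

lemma cycle9_adj_cases:
  assumes "cycle9_adj u w" "cycle9_adj w v" "u < 9" "v < 9" "u \<noteq> v"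
  shows "w = Suc u mod 9 \<and> v = Suc (Suc u) mod 9 \<or> w = Suc v mod 9 \<and> u = Suc (Suc v) mod 9"
proof -
  have "Suc u mod 9 \<noteq> Suc v mod 9"
    using assms(3-5) by (auto simp: mod_Suc)
  then show ?thesis
    using assms(1,2,5) by (auto simp: cycle9_adj_def mod_Suc_eq)
qed

lemma Suc_mod_9_neq: "Suc u mod 9 \<noteq> u"
  by (cases "u < 9") (auto simp: mod_Suc)

lemma Suc_Suc_mod_9_neq: "Suc (Suc u) mod 9 \<noteq> u"
  by (cases "u < 9") (auto simp: mod_Suc)

text \<open>Since 3 divides 9, the residue modulo 3 advances by one even at the step from 8 to
  0.\<close>

lemma mod_3_Suc_mod_9: "(Suc u mod 9) mod 3 = Suc u mod 3"
  by (simp add: mod_mod_cancel)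

lemma mod_3_Suc_Suc_mod_9: "(Suc (Suc u) mod 9) mod 3 = Suc (Suc u) mod 3"
  by (simp add: mod_mod_cancel)

lemma Suc_mod_3_neq: "Suc u mod 3 \<noteq> u mod 3" "Suc (Suc u) mod 3 \<noteq> u mod 3"
  by (simp_all add: mod_Suc)

lemma wf_digraph_cycle9: "wf_digraph (with_proj cycle9)"
  by unfold_locales (auto simp: cycle9_def)

lemma simple_graph_cycle9: "simple_graph (with_proj cycle9)"
proof -
  interpret wf_digraph "with_proj cycle9"
    by (rule wf_digraph_cycle9)
  have "cycle9_adj u u \<Longrightarrow> False" for u
    using Suc_mod_9_neq[of u] by (auto simp: cycle9_adj_def)
  then have "loopfree_digraph (with_proj cycle9)"
    by unfold_locales (auto simp: cycle9_def)
  moreover have "nomulti_digraph (with_proj cycle9)"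
    by unfold_locales (auto simp: arc_to_ends_def)
  moreover have "sym_digraph (with_proj cycle9)"
    by unfold_locales (auto simp: cycle9_def symmetric_def intro: symI cycle9_adj_sym)
  moreover have "verts (with_proj cycle9) \<noteq> {}"
    by (simp add: cycle9_def lessThan_empty_iff)
  ultimately show ?thesis
    unfolding simple_graph_def by blast
qed

lemma dominates_cycle9_iff: "u \<rightarrow>\<^bsub>with_proj cycle9\<^esub> v \<longleftrightarrow> u < 9 \<and> v < 9 \<and> cycle9_adj u v"
  by (simp add: cycle9_def)

section \<open>Squares of the induced subgraphs of the 9-cycle\<close>

text \<open>The middle vertex ranges over \<open>S\<close> only, because the square is taken after
  restriction; this is how these graphs differ from induced subgraphs of the square.\<close>

lemma square_induce_cycle9_dominates_iff:
  assumes "S \<subseteq> {..<9}"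
  shows "u \<rightarrow>\<^bsub>with_proj (graph_square (with_proj cycle9 \<restriction> S))\<^esub> v \<longleftrightarrow>
    u \<in> S \<and> v \<in> S \<and> u \<noteq> v \<and> (cycle9_adj u v \<or> (\<exists>w\<in>S. cycle9_adj u w \<and> cycle9_adj w v))"
proof -
  interpret wf_digraph "with_proj cycle9 \<restriction> S"
    by (rule wf_digraph.wellformed_induce_subgraph[OF wf_digraph_cycle9])
  have "x \<rightarrow>\<^bsub>with_proj cycle9 \<restriction> S\<^esub> y \<longleftrightarrow> x \<in> S \<and> y \<in> S \<and> cycle9_adj x y" for x y
    using assms unfolding dominates_induce_subgraph_iff dominates_cycle9_iff by auto
  then show ?thesis
    unfolding graph_square_dominates_iff by blast
qed

text \<open>The cases follow the longest run of consecutive vertices in \<open>S\<close>: at least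
  three, two, or one. The run, cut off at three, is the clique, and its size is the number of
  colours.\<close>

lemma chromatic_number_square_induce_cycle9:
  assumes S: "S \<subseteq> {..<9}" "S \<noteq> {}"
  defines "H \<equiv> with_proj (graph_square (with_proj cycle9 \<restriction> S))"
  shows "chromatic_number H = clique_number H"
proof -
  note dom = square_induce_cycle9_dominates_iff[OF S(1), folded H_def]
  have verts: "verts H = S"
    by (simp add: H_def graph_square_def)
  have less_9: "v < 9" if "v \<in> S" for v
    using S(1) that by auto
  show ?thesis
  proof (cases "\<exists>u\<in>S. Suc u mod 9 \<in> S \<and> Suc (Suc u) mod 9 \<in> S")
    case True
    then obtain u where u: "u \<in> S" "Suc u mod 9 \<in> S" "Suc (Suc u) mod 9 \<in> S"
      by blast
    let ?T = "{u, Suc u mod 9, Suc (Suc u) mod 9}"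
    have ne: "u \<noteq> Suc u mod 9" "u \<noteq> Suc (Suc u) mod 9" "Suc u mod 9 \<noteq> Suc (Suc u) mod 9"
      using Suc_mod_9_neq[of u] Suc_Suc_mod_9_neq[of u] Suc_mod_9_neq[of "Suc u mod 9"]
      by (simp_all add: mod_Suc_eq)
    have "cycle9_adj u (Suc u mod 9)" "cycle9_adj (Suc u mod 9) (Suc (Suc u) mod 9)"
      by (simp_all add: cycle9_adj_def mod_Suc_eq)
    then have "clique H ?T"
      using u ne cycle9_adj_sym unfolding clique_def dom verts by blast
    \<comment> \<open>Residues modulo 3 differ at one and at two steps along the cycle;
      \<open>Suc\<close> shifts them into the palette \<open>{1..3}\<close>.\<close>
    moreover have "proper_coloring H (card ?T) (\<lambda>v. Suc (v mod 3))"
    proof -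
      have adj: "x mod 3 \<noteq> y mod 3" if "cycle9_adj x y" for x y
        using that Suc_mod_3_neq(1)[of x] Suc_mod_3_neq(1)[of y]
        unfolding cycle9_adj_def by (metis mod_3_Suc_mod_9)
      have "x mod 3 \<noteq> y mod 3" if xy: "x \<rightarrow>\<^bsub>H\<^esub> y" for x y
      proof (cases "cycle9_adj x y")
        case False
        then obtain w where "cycle9_adj x w" "cycle9_adj w y" "x \<in> S" "y \<in> S" "x \<noteq> y"
          using xy unfolding dom by blast
        then have "y = Suc (Suc x) mod 9 \<or> x = Suc (Suc y) mod 9"
          using cycle9_adj_cases less_9 by blast
        then show ?thesis
          using Suc_mod_3_neq(2)[of x] Suc_mod_3_neq(2)[of y] by (metis mod_3_Suc_Suc_mod_9)
      qed (rule adj)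
      moreover have "card ?T = 3"
        using ne by simp
      moreover have "Suc (v mod 3) \<in> {1..3}" for v :: nat
        using mod_less_divisor[of 3 v] by simp
      ultimately show ?thesis
        unfolding proper_coloring_def by auto
    qed
    ultimately show ?thesis
      by (intro chromatic_number_eq_clique_numberI[of H ?T]) auto
  next
    case no_triple: False
    \<comment> \<open>Two steps inside \<open>S\<close> would give three consecutive vertices, so
      squaring adds no edge.\<close>
    have H_adj: "u \<rightarrow>\<^bsub>H\<^esub> v \<longleftrightarrow> u \<in> S \<and> v \<in> S \<and> u \<noteq> v \<and> cycle9_adj u v" for u v
    proof -
      have False if "u \<in> S" "v \<in> S" "u \<noteq> v" "w \<in> S" "cycle9_adj u w" "cycle9_adj w v" for w
        using cycle9_adj_cases[of u w v] that less_9 no_triple by metis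
      then show ?thesis
        unfolding dom by blast
    qed
    show ?thesis
    proof (cases "\<exists>u\<in>S. Suc u mod 9 \<in> S")
      case True
      then obtain u where u: "u \<in> S" "Suc u mod 9 \<in> S"
        by blast
      \<comment> \<open>Colour 2 marks the vertices whose predecessor lies in \<open>S\<close>.
        Every edge joins a vertex to its successor, and without triples the first of the two gets
        colour 1.\<close>
      define f :: "nat \<Rightarrow> nat" where "f v = (if \<exists>w\<in>S. v = Suc w mod 9 then 2 else 1)" for v
      have "card {u, Suc u mod 9} = 2"
        using Suc_mod_9_neq[of u] by simp
      moreover have "cycle9_adj u (Suc u mod 9)"
        by (simp add: cycle9_adj_def)
      then have "clique H {u, Suc u mod 9}"
        using u cycle9_adj_sym unfolding clique_def verts H_adj by blast
      moreover
      have step: "f x = 1 \<and> f (Suc x mod 9) = 2" if "x \<in> S" "Suc x mod 9 \<in> S" for x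
      proof -
        have "\<not> (\<exists>w\<in>S. x = Suc w mod 9)"
          using that no_triple by (metis mod_Suc_eq)
        then show ?thesis
          using that(1) by (auto simp: f_def)
      qed
      have "f x \<noteq> f y" if "x \<rightarrow>\<^bsub>H\<^esub> y" for x y
      proof -
        have "x \<in> S" "y \<in> S" "y = Suc x mod 9 \<or> x = Suc y mod 9"
          using that unfolding H_adj cycle9_adj_def by blast+
        then have "f x = 1 \<and> f y = 2 \<or> f y = 1 \<and> f x = 2"
          using step[of x] step[of y] by metis
        then show ?thesis by auto
      qed
      then have "proper_coloring H 2 f"
        unfolding proper_coloring_def by (auto simp: f_def)
      ultimately show ?thesis
        by (intro chromatic_number_eq_clique_numberI[of H "{u, Suc u mod 9}"]) auto
    next
      case False
      obtain u where "u \<in> S"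
        using S(2) by blast
      then have "clique H {u}"
        by (simp add: clique_def verts del: with_proj_simps)
      \<comment> \<open>With no two consecutive vertices the square has no edges, so one colour
        suffices.\<close>
      moreover have "\<not> x \<rightarrow>\<^bsub>H\<^esub> y" for x y
        using False unfolding H_adj cycle9_adj_def by blast
      then have "proper_coloring H (card {u}) (\<lambda>_. 1)"
        unfolding proper_coloring_def by auto
      ultimately show ?thesis
        by (intro chromatic_number_eq_clique_numberI[of H "{u}"]) auto
    qed
  qed
qed

lemma kd_perfect_cycle9: "kd_perfect 2 2 (with_proj cycle9)"
  unfolding kd_perfect_def
proof (intro conjI allI impI)
  fix S :: "nat set"
  assume S: "S \<subseteq> verts (with_proj cycle9) \<and> S \<noteq> {}"
  then have "S \<subseteq> {..<9}"
    by (simp add: cycle9_def)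
  have "wf_digraph (with_proj cycle9 \<restriction> S)"
    by (rule wf_digraph.wellformed_induce_subgraph[OF wf_digraph_cycle9])
  moreover have "symmetric (with_proj cycle9 \<restriction> S)"
    unfolding symmetric_def
    by (rule symI, unfold dominates_induce_subgraph_iff dominates_cycle9_iff)
      (blast intro: cycle9_adj_sym)
  ultimately interpret sym_digraph "with_proj cycle9 \<restriction> S"
    by (simp add: sym_digraph_def sym_digraph_axioms_def)
  show "kd_chromatic_number 2 2 (with_proj cycle9 \<restriction> S) =
      ceil_quotient (kd_clique_number 2 2 (with_proj cycle9 \<restriction> S)) (2 - 1)"
    using chromatic_number_square_induce_cycle9[of S] S \<open>S \<subseteq> {..<9}\<close>
    unfolding kd_chromatic_number_def kd_clique_number_def chromatic_number_def
      clique_number_def kd_coloring_2_2_iff kd_clique_2_2_iff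
    by simp
qed simp_all

section \<open>The square of the whole 9-cycle is not perfect\<close>

lemma square_cycle9_dominates_iff:
  "u \<rightarrow>\<^bsub>with_proj (graph_square (with_proj cycle9))\<^esub> v \<longleftrightarrow>
    u < 9 \<and> v < 9 \<and> u \<noteq> v \<and>
    (cycle9_adj u v \<or> v = Suc (Suc u) mod 9 \<or> u = Suc (Suc v) mod 9)"
  (is "?L \<longleftrightarrow> ?R")
proof -
  interpret wf_digraph "with_proj cycle9"
    by (rule wf_digraph_cycle9)
  \<comment> \<open>The middle vertex is the successor of \<open>x\<close>. Applied to
    \<open>v\<close>, the walk is then reversed by symmetry.\<close>
  have two_steps: "\<exists>w<9. cycle9_adj x w \<and> cycle9_adj w (Suc (Suc x) mod 9)" for x
    by (rule exI[of _ "Suc x mod 9"]) (simp add: cycle9_adj_def mod_Suc_eq)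
  show ?thesis
  proof
    assume ?L
    then show ?R
      unfolding graph_square_dominates_iff dominates_cycle9_iff
      using cycle9_adj_cases[of u _ v] by blast
  next
    assume R: ?R
    then have "cycle9_adj u v \<or> (\<exists>w<9. cycle9_adj u w \<and> cycle9_adj w v)"
      using two_steps[of u] two_steps[of v] cycle9_adj_sym by metis
    then show ?L
      using R unfolding graph_square_dominates_iff dominates_cycle9_iff by blast
  qed
qed

lemma not_perfect_square_cycle9: "\<not> perfect (with_proj (graph_square (with_proj cycle9)))"
proof
  \<comment> \<open>Successive members are at distance 2, while 8 and 0 are adjacent in the cycle
    itself, which closes an induced 5-cycle of the square.\<close>
  define S where "S = {0, 2, 4, 6, 8 :: nat}"
  define Q where "Q = with_proj (graph_square (with_proj cycle9)) \<restriction> S"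
  assume "perfect (with_proj (graph_square (with_proj cycle9)))"
  moreover have "S \<subseteq> verts (with_proj (graph_square (with_proj cycle9)))" "S \<noteq> {}"
    by (simp_all add: graph_square_def cycle9_def S_def)
  ultimately have eq: "chromatic_number Q = clique_number Q"
    by (simp add: perfect_def Q_def)
  have verts: "verts Q = S"
    by (simp add: Q_def)
  have Q: "u \<rightarrow>\<^bsub>Q\<^esub> v \<longleftrightarrow> u \<in> S \<and> v \<in> S \<and> u < 9 \<and> v < 9 \<and> u \<noteq> v \<and>
      (cycle9_adj u v \<or> v = Suc (Suc u) mod 9 \<or> u = Suc (Suc v) mod 9)" for u v
    unfolding Q_def dominates_induce_subgraph_iff
      square_cycle9_dominates_iff by blast
  have edge: "0 \<rightarrow>\<^bsub>Q\<^esub> 2" "2 \<rightarrow>\<^bsub>Q\<^esub> 4" "4 \<rightarrow>\<^bsub>Q\<^esub> 6" "6 \<rightarrow>\<^bsub>Q\<^esub> 8" "8 \<rightarrow>\<^bsub>Q\<^esub> 0"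
    unfolding Q by (simp_all add: S_def cycle9_adj_def)
  have edgeD: "v = u + 2 \<or> u = v + 2 \<or> u = 0 \<and> v = 8 \<or> u = 8 \<and> v = 0" if "u \<rightarrow>\<^bsub>Q\<^esub> v" for u v
    using that unfolding Q S_def by (elim conjE insertE emptyE; simp add: cycle9_adj_def)
  have "enat 3 \<le> chromatic_number Q"
    unfolding chromatic_number_def
  proof (rule INF_greatest)
    fix c
    assume "c \<in> {c. 0 < c \<and> (\<exists>f. proper_coloring Q c f)}"
    then obtain f where f: "proper_coloring Q c f"
      by blast
    \<comment> \<open>Two colours would have to alternate around a cycle of odd length.\<close>
    have "f 0 \<noteq> f 2" "f 2 \<noteq> f 4" "f 4 \<noteq> f 6" "f 6 \<noteq> f 8" "f 8 \<noteq> f 0"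
      using f edge unfolding proper_coloring_def by blast+
    moreover have "f ` {0, 2, 4, 6, 8} \<subseteq> {1..c}"
      using f by (simp add: proper_coloring_def verts S_def)
    ultimately have "\<not> c \<le> 2"
      by auto
    then show "enat 3 \<le> enat c"
      by simp
  qed
  moreover have "clique_number Q \<le> enat 2"
    unfolding clique_number_def
  proof (rule SUP_least)
    fix T
    assume "T \<in> {T. clique Q T}"
    then have "T \<subseteq> S" and T: "\<And>u v. u \<in> T \<Longrightarrow> v \<in> T \<Longrightarrow> u \<noteq> v \<Longrightarrow> u \<rightarrow>\<^bsub>Q\<^esub> v"
      unfolding clique_def verts by blast+
    have "card T \<le> 2"
    proof (rule ccontr)
      assume "\<not> card T \<le> 2"
      then have "3 \<le> card T"
        by simp
      then obtain B where "B \<subseteq> T" "card B = 3"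
        by (rule obtain_subset_with_card_n)
      then obtain x y z where "{x, y, z} \<subseteq> T" "x \<noteq> y" "y \<noteq> z" "x \<noteq> z"
        by (auto simp: card_3_iff)
      then have "x \<rightarrow>\<^bsub>Q\<^esub> y" "y \<rightarrow>\<^bsub>Q\<^esub> z" "x \<rightarrow>\<^bsub>Q\<^esub> z"
        using T by blast+
      \<comment> \<open>Ends of an edge differ by 2 or 8. Two such signed differences add up to 0,
        4, 6, 10 or 16 in absolute value, never to 2 or 8, so there is no triangle.\<close>
      from this[THEN edgeD] show False
        by (elim disjE conjE) linarith+
    qed
    moreover have "finite T"
      using \<open>T \<subseteq> S\<close> by (rule finite_subset) (simp add: S_def)
    ultimately show "esize T \<le> enat 2"
      by (simp add: esize_def)
  qed
  ultimately have "enat 3 \<le> enat 2"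
    using eq by (metis order_trans)
  then show False
    by simp
qed

theorem proposition3p3:
  shows "\<exists>G :: nat pair_pre_digraph.
    simple_graph (with_proj G) \<and> kd_perfect 2 2 (with_proj G) \<and>
    \<not> perfect (with_proj (graph_square (with_proj G)))"
  using simple_graph_cycle9 kd_perfect_cycle9 not_perfect_square_cycle9 by blast

end
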